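(* Let $n\ge1$, $x_0\in\mathbb{R}^d$, $\bar\Delta>0$. For $i\in\{1,\dots,n\}$ let $f_i:\mathbb{R}^d\to\mathbb{R}$ be in $\mathcal{C}^2$ and let $\{\widetilde f_{i,\Delta}\}_{\Delta\in(0,\bar\Delta]}$ be a class of (twice differentiable) models of $f_i$ that provides order-$\infty$ function accuracy of $f_i$ at $x_0$ with constant $\kappa_i^f(x_0)=0$, order-$N_i^g$ gradient accuracy of $f_i$ at $x_0$ with constant $\kappa_i^g(x_0)$, and order-$N_i^h$ Hessian accuracy of $f_i$ at $x_0$ with constant $\kappa_i^h(x_0)$, where $N_i^g,N_i^h\ge0$. Put $F=f_1\cdots f_n$, $\widetilde F_\Delta=\widetilde f_{1,\Delta}\cdots\widetilde f_{n,\Delta}$, $F_i=\prod_{j\neq i}f_j$, and $N_F^{gh}=\min\{N_i^g,N_i^h:i=1,\dots,n\}$. Then for every $\Delta\in(0,\bar\Delta]$ $$\|\nabla^2F(x_0)-\nabla^2\widetilde F_\Delta(x_0)\|\le K_F^h(x_0)\Delta^{N_F^{gh}},$$ where $$K_F^h(x_0)=\sum_{i=1}^n\left[\sum_{j\ne i}\left(\prod_{k\ne i,j}|f_k(x_0)|\right)\big(M_{\nabla f_j}(x_0)+M_{\nabla\widetilde f_j}(x_0)\big)\right]\kappa_i^g(x_0)\bar\Delta^{N_i^g-N_F^{gh}}+\sum_{i=1}^n|F_i(x_0)|\kappa_i^h(x_0)\bar\Delta^{N_i^h-N_F^{gh}}.$$ In particular, $\{\widetilde F_\Delta\}_{(0,\bar\Delta]}$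 provides order-$N_F^{gh}$ Hessian accuracy of $F$ at $x_0$.
   Context: $\|\cdot\|$ is the Euclidean norm for vectors and the induced operator norm for matrices; $B_\Delta(x_0)$ is the closed ball of radius $\Delta$ centered at $x_0$; indices in sums and products range over $\{1,\dots,n\}$ with the stated exclusions, and empty products equal $1$. A class of models of $f:\mathbb{R}^d\to\mathbb{R}$ is a family of functions $\widetilde f_\Delta:\mathbb{R}^d\to\mathbb{R}$ indexed by $\Delta\in(0,\bar\Delta]$; when gradients or Hessians of models appear the models are understood to be differentiable, respectively twice differentiable. Order-$\infty$ function accuracy of $f$ at $x_0$ with constant $0$ means $\widetilde f_\Delta(x_0)=f(x_0)$ for all $\Delta\in(0,\bar\Delta]$. For real $N\ge0$ and $\kappa\ge0$, the class provides order-$N$ gradient (respectively Hessian) accuracy of $f$ at $x_0$ with constant $\kappa$ if $\|\nabla f(x_0)-\nabla\widetilde f_\Delta(x_0)\|\le\kappa\Delta^N$ (respectively $\|\nabla^2f(x_0)-\nabla^2\widetilde f_\Delta(x_0)\|\le\kappa\Delta^N$) for all $\Delta\in(0,\bar\Delta]$. Without mention of a constant, it is meant that some such $\kappa\ge0$ exists. Bounds: $M_{\nabla f_i}(x_0)$ denotes a number with $\|\nabla f_i(x)\|\le M_{\nabla f_i}(x_0)$ for all $x\in B_{\bar\Delta}(x_0)$; $M_{\nabla\widetilde f_i}(x_0)$ denotes a number with $\|\nabla\widetilde f_{i,\Delta}(x_0)\|\le M_{\nabla\widetilde f_i}(x_0)$ for all $\Delta\in(0,\bar\Delta]$ (it exists;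 one may take $\bar\Delta^{N_i^g}\kappa_i^g(x_0)+M_{\nabla f_i}(x_0)$). *)

theory Defs
  imports "HOL-Analysis.Analysis"
begin

definition grad :: "(real ^ 'd \<Rightarrow> real) \<Rightarrow> real ^ 'd \<Rightarrow> real ^ 'd" where
  "grad f x = (THE g. GDERIV f x :> g)"

lemma grad_eqI:
  assumes "GDERIV f x :> g"
  shows "grad f x = g"
  unfolding grad_def
proof (rule the_equality, rule assms)
  fix h assume "GDERIV f x :> h"
  then have "(\<lambda>v. v \<bullet> h) = (\<lambda>v. v \<bullet> g)"
    using assms unfolding gderiv_def by (rule has_derivative_unique)
  then show "h = g"
    by (metis vector_eq_ldot)
qed

text \<open>The \<open>(i, j)\<close> entry is the \<open>j\<close>-th partial derivative of the \<open>i\<close>-th component of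
  the gradient.\<close>

definition hessian :: "(real ^ 'd \<Rightarrow> real) \<Rightarrow> real ^ 'd \<Rightarrow> real ^ 'd ^ 'd" where
  "hessian f x = matrix (frechet_derivative (grad f) (at x))"

definition matrix_norm :: "real ^ 'd ^ 'd \<Rightarrow> real" where
  "matrix_norm A = onorm ((*v) A)"

definition twice_differentiable :: "(real ^ 'd \<Rightarrow> real) \<Rightarrow> bool" where
  "twice_differentiable f \<longleftrightarrow>
     (\<forall>x. f differentiable at x) \<and> (\<forall>x. grad f differentiable at x)"

definition C2 :: "(real ^ 'd \<Rightarrow> real) \<Rightarrow> bool" where
  "C2 f \<longleftrightarrow> twice_differentiable f \<and> continuous_on UNIV (hessian f)"

text \<open>A class of models \<open>m\<close> maps \<open>\<Delta>\<close> to the model with that radius; only the radii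
  \<open>\<Delta> \<in> {0<..\<Delta>max}\<close> matter. The accuracy notions for gradients and Hessians include the
  requirement that the models have such derivatives, since \<^const>\<open>grad\<close> and \<^const>\<open>hessian\<close>
  are total functions.\<close>

definition exact_function_accuracy ::
  "(real ^ 'd \<Rightarrow> real) \<Rightarrow> (real \<Rightarrow> real ^ 'd \<Rightarrow> real) \<Rightarrow> real \<Rightarrow> real ^ 'd \<Rightarrow> bool" where
  "exact_function_accuracy f m \<Delta>max x0 \<longleftrightarrow> (\<forall>\<Delta>\<in>{0<..\<Delta>max}. m \<Delta> x0 = f x0)"

definition gradient_accuracy ::
  "(real ^ 'd \<Rightarrow> real) \<Rightarrow> (real \<Rightarrow> real ^ 'd \<Rightarrow> real) \<Rightarrow> real \<Rightarrow> real ^ 'd \<Rightarrow> real \<Rightarrow> real \<Rightarrow> bool" where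
  "gradient_accuracy f m \<Delta>max x0 N \<kappa> \<longleftrightarrow>
     (\<forall>\<Delta>\<in>{0<..\<Delta>max}. (\<forall>x. m \<Delta> differentiable at x) \<and>
        norm (grad f x0 - grad (m \<Delta>) x0) \<le> \<kappa> * \<Delta> powr N)"

definition hessian_accuracy ::
  "(real ^ 'd \<Rightarrow> real) \<Rightarrow> (real \<Rightarrow> real ^ 'd \<Rightarrow> real) \<Rightarrow> real \<Rightarrow> real ^ 'd \<Rightarrow> real \<Rightarrow> real \<Rightarrow> bool" where
  "hessian_accuracy f m \<Delta>max x0 N \<kappa> \<longleftrightarrow>
     (\<forall>\<Delta>\<in>{0<..\<Delta>max}. twice_differentiable (m \<Delta>) \<and>
        matrix_norm (hessian f x0 - hessian (m \<Delta>) x0) \<le> \<kappa> * \<Delta> powr N)"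

definition provides_hessian_accuracy ::
  "(real ^ 'd \<Rightarrow> real) \<Rightarrow> (real \<Rightarrow> real ^ 'd \<Rightarrow> real) \<Rightarrow> real \<Rightarrow> real ^ 'd \<Rightarrow> real \<Rightarrow> bool" where
  "provides_hessian_accuracy f m \<Delta>max x0 N \<longleftrightarrow>
     (\<exists>\<kappa>\<ge>0. hessian_accuracy f m \<Delta>max x0 N \<kappa>)"

end

theory Submission
  imports Defs
begin

text \<open>Write \<open>g\<^sub>i\<close>, \<open>H\<^sub>i\<close> for the gradient and Hessian of \<open>f\<^sub>i\<close> at \<open>x\<^sub>0\<close>. The Hessian of the product is
  \<open>\<Sum>\<^sub>i F\<^sub>i H\<^sub>i + \<Sum>\<^sub>i \<Sum>\<^sub>j\<^sub>\<noteq>\<^sub>i P\<^sub>i\<^sub>j g\<^sub>i g\<^sub>j\<^sup>T\<close> with \<open>P\<^sub>i\<^sub>j\<close> the product of the remaining values. Since the models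
  are exact at \<open>x\<^sub>0\<close>, the factors \<open>F\<^sub>i\<close> and \<open>P\<^sub>i\<^sub>j\<close> agree for the functions and the models, so only the
  differences of the \<open>H\<^sub>i\<close> and of the rank-one terms matter. The latter are split as
  \<open>(g\<^sub>i - g'\<^sub>i) g\<^sub>j\<^sup>T + g'\<^sub>i (g\<^sub>j - g'\<^sub>j)\<^sup>T\<close>, and \<open>P\<^sub>i\<^sub>j = P\<^sub>j\<^sub>i\<close> lets the second half be reindexed.\<close>

section \<open>Gradients and Hessians as Frechet derivatives\<close>

lemma GDERIV_grad:
  fixes f :: "real ^ 'd \<Rightarrow> real"
  assumes "f differentiable at x"
  shows "GDERIV f x :> grad f x"
proof -
  obtain f' where f': "(f has_derivative f') (at x)"
    using assms unfolding differentiable_def by blast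
  then have lin: "linear f'"
    by (rule has_derivative_linear)
  \<comment> \<open>Riesz representation: a linear functional into the reals is the inner product
    with the image of 1 under its adjoint.\<close>
  have "f' = (\<lambda>h. h \<bullet> adjoint f' 1)"
    by (simp add: fun_eq_iff adjoint_works[OF lin])
  then have "GDERIV f x :> adjoint f' 1"
    using f' unfolding gderiv_def by metis
  then show ?thesis
    using grad_eqI by metis
qed

text \<open>The Hessian is used only through its action on vectors. Uniqueness of the derivative
  then determines it from any formula for the derivative of the gradient, and no matrix entries have
  to be computed.\<close>

lemma hessian_mult_eqI:
  fixes f :: "real ^ 'd \<Rightarrow> real"
  assumes "(grad f has_derivative D) (at x)"
  shows "hessian f x *v h = D h"
proof -
  have "frechet_derivative (grad f) (at x) = D"
    using frechet_derivative_at[OF assms] by simp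
  then show ?thesis
    unfolding hessian_def using matrix_works[of D h] has_derivative_linear[OF assms]
    by (simp add: linear_matrix_vector_mul_eq)
qed

lemma has_derivative_grad:
  fixes f :: "real ^ 'd \<Rightarrow> real"
  assumes "twice_differentiable f"
  shows "(grad f has_derivative (\<lambda>h. hessian f x *v h)) (at x)"
proof -
  obtain D where D: "(grad f has_derivative D) (at x)"
    using assms unfolding twice_differentiable_def differentiable_def by blast
  then show ?thesis
    using hessian_mult_eqI[OF D] by simp
qed

section \<open>The operator norm\<close>

lemma matrix_norm_mult_le:
  "norm (A *v h) \<le> matrix_norm A * norm (h :: real ^ 'd)"
  unfolding matrix_norm_def by (rule onorm) (rule matrix_vector_mul_bounded_linear)

lemma matrix_norm_leI:
  assumes "\<And>h :: real ^ 'd. norm (A *v h) \<le> C * norm h"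
  shows "matrix_norm A \<le> C"
  unfolding matrix_norm_def using assms by (rule onorm_le)

section \<open>First and second order product rules\<close>

lemma GDERIV_prod:
  fixes f :: "'i \<Rightarrow> real ^ 'd \<Rightarrow> real"
  assumes "\<And>i. i \<in> I \<Longrightarrow> f i differentiable at x"
  shows "GDERIV (\<lambda>x. \<Prod>i\<in>I. f i x) x :> (\<Sum>i\<in>I. (\<Prod>j\<in>I - {i}. f j x) *\<^sub>R grad (f i) x)"
proof -
  have "((\<lambda>x. \<Prod>i\<in>I. f i x) has_derivative
      (\<lambda>h. \<Sum>i\<in>I. (h \<bullet> grad (f i) x) * (\<Prod>j\<in>I - {i}. f j x))) (at x)"
    by (rule has_derivative_prod) (use assms GDERIV_grad in \<open>auto simp: gderiv_def\<close>)
  then show ?thesis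
    unfolding gderiv_def by (simp add: inner_sum_right mult.commute)
qed

text \<open>The product rule is applied a second time, to the scalar coefficients in the gradient of
  the product. Their derivatives produce the rank-one terms, written here as they act on
  \<open>h\<close>.\<close>

lemma has_derivative_grad_prod:
  fixes f :: "'i \<Rightarrow> real ^ 'd \<Rightarrow> real"
  assumes f: "\<And>i. i \<in> I \<Longrightarrow> twice_differentiable (f i)"
  shows "(grad (\<lambda>x. \<Prod>i\<in>I. f i x) has_derivative
    (\<lambda>h. \<Sum>i\<in>I. (\<Prod>j\<in>I - {i}. f j x) *\<^sub>R (hessian (f i) x *v h) +
       (\<Sum>j\<in>I - {i}. (h \<bullet> grad (f j) x) * (\<Prod>k\<in>I - {i, j}. f k x)) *\<^sub>R grad (f i) x)) (at x)"
proof -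
  have diff: "f i differentiable at y" if "i \<in> I" for i y
    using f[OF that] unfolding twice_differentiable_def by blast
  \<comment> \<open>Differentiability at every point makes this an equality of functions, which can
    be differentiated once more.\<close>
  have grad: "grad (\<lambda>x. \<Prod>i\<in>I. f i x) = (\<lambda>x. \<Sum>i\<in>I. (\<Prod>j\<in>I - {i}. f j x) *\<^sub>R grad (f i) x)"
    by (rule ext, rule grad_eqI, rule GDERIV_prod) (rule diff)
  have prod: "((\<lambda>x. \<Prod>j\<in>I - {i}. f j x) has_derivative
      (\<lambda>h. \<Sum>j\<in>I - {i}. (h \<bullet> grad (f j) x) * (\<Prod>k\<in>I - {i, j}. f k x))) (at x)" for i
  proof -
    have "((\<lambda>x. \<Prod>j\<in>I - {i}. f j x) has_derivative
      (\<lambda>h. \<Sum>j\<in>I - {i}. (h \<bullet> grad (f j) x) * (\<Prod>k\<in>I - {i} - {j}. f k x))) (at x)"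
      by (rule has_derivative_prod) (use diff GDERIV_grad in \<open>auto simp: gderiv_def\<close>)
    \<comment> \<open>Writing the index set with \<open>{i, j}\<close> exposes the symmetry in
      \<open>i\<close> and \<open>j\<close> on which the later exchange of sums relies.\<close>
    moreover have "I - {i} - {j} = I - {i, j}" for j
      by blast
    ultimately show ?thesis
      by simp
  qed
  show ?thesis
    unfolding grad
    by (rule has_derivative_sum has_derivative_scaleR prod has_derivative_grad f | assumption)+
qed

text \<open>Hessian accuracy of the product models includes their twice differentiability; this
  supplies it.\<close>

lemma twice_differentiable_prod:
  fixes f :: "'i \<Rightarrow> real ^ 'd \<Rightarrow> real"
  assumes f: "\<And>i. i \<in> I \<Longrightarrow> twice_differentiable (f i)"
  shows "twice_differentiable (\<lambda>x. \<Prod>i\<in>I. f i x)"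
proof -
  have "(\<lambda>x. \<Prod>i\<in>I. f i x) differentiable at x" for x
    using GDERIV_prod[of I f x] f unfolding twice_differentiable_def gderiv_def
    by (meson differentiableI)
  moreover have "grad (\<lambda>x. \<Prod>i\<in>I. f i x) differentiable at x" for x
    using has_derivative_grad_prod[of I f x, OF f] by (meson differentiableI)
  ultimately show ?thesis
    unfolding twice_differentiable_def by blast
qed

section \<open>The estimate for two products that agree factorwise at a point\<close>

text \<open>This is the estimate for one fixed radius, with \<open>g\<close> as the models. It keeps
  the actual norms, so that accuracy orders and gradient bounds enter only when it is
  applied.\<close>

lemma matrix_norm_hessian_prod_diff_le:
  fixes f g :: "'i \<Rightarrow> real ^ 'd \<Rightarrow> real"
  assumes fin: "finite I"
    and f: "\<And>i. i \<in> I \<Longrightarrow> twice_differentiable (f i)"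
    and g: "\<And>i. i \<in> I \<Longrightarrow> twice_differentiable (g i)"
    and eq: "\<And>i. i \<in> I \<Longrightarrow> g i x = f i x"
  shows "matrix_norm (hessian (\<lambda>x. \<Prod>i\<in>I. f i x) x - hessian (\<lambda>x. \<Prod>i\<in>I. g i x) x)
    \<le> (\<Sum>i\<in>I. (\<Sum>j\<in>I - {i}. (\<Prod>k\<in>I - {i, j}. \<bar>f k x\<bar>) * (norm (grad (f j) x) + norm (grad (g j) x)))
            * norm (grad (f i) x - grad (g i) x))
      + (\<Sum>i\<in>I. \<bar>\<Prod>j\<in>I - {i}. f j x\<bar> * matrix_norm (hessian (f i) x - hessian (g i) x))"
    (is "_ \<le> ?G + ?H")
proof (rule matrix_norm_leI)
  fix h :: "real ^ 'd"
  let ?u = "\<lambda>i. grad (f i) x" and ?v = "\<lambda>i. grad (g i) x"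
  let ?A = "\<lambda>i. hessian (f i) x" and ?B = "\<lambda>i. hessian (g i) x"
  let ?F = "\<lambda>i. \<Prod>j\<in>I - {i}. f j x"
  let ?P = "\<lambda>i j. \<Prod>k\<in>I - {i, j}. f k x"
  let ?Q = "\<lambda>i j. \<Prod>k\<in>I - {i, j}. \<bar>f k x\<bar>"
  \<comment> \<open>Agreement at \<open>x\<close> enters here: \<open>S = {i}\<close> and
    \<open>S = {i, j}\<close> cover the coefficients of both kinds of terms.\<close>
  have Pg: "(\<Prod>k\<in>I - S. g k x) = (\<Prod>k\<in>I - S. f k x)" for S
    by (rule prod.cong) (auto simp: eq)
  have hf: "hessian (\<lambda>x. \<Prod>i\<in>I. f i x) x *v h =
      (\<Sum>i\<in>I. ?F i *\<^sub>R (?A i *v h) + (\<Sum>j\<in>I - {i}. (h \<bullet> ?u j) * ?P i j) *\<^sub>R ?u i)"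
    by (rule hessian_mult_eqI[OF has_derivative_grad_prod[OF f]])
  have hg: "hessian (\<lambda>x. \<Prod>i\<in>I. g i x) x *v h =
      (\<Sum>i\<in>I. ?F i *\<^sub>R (?B i *v h) + (\<Sum>j\<in>I - {i}. (h \<bullet> ?v j) * ?P i j) *\<^sub>R ?v i)"
    using hessian_mult_eqI[OF has_derivative_grad_prod[of I g x, OF g], of h] unfolding Pg by simp
  have diff: "(hessian (\<lambda>x. \<Prod>i\<in>I. f i x) x - hessian (\<lambda>x. \<Prod>i\<in>I. g i x) x) *v h =
      (\<Sum>i\<in>I. \<Sum>j\<in>I - {i}. ?P i j *\<^sub>R ((h \<bullet> ?u j) *\<^sub>R ?u i - (h \<bullet> ?v j) *\<^sub>R ?v i))
      + (\<Sum>i\<in>I. ?F i *\<^sub>R ((?A i - ?B i) *v h))"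
    unfolding matrix_vector_mult_diff_rdistrib hf hg sum_subtractf[symmetric] sum.distrib[symmetric]
    by (rule sum.cong)
      (simp_all add: scaleR_sum_left scaleR_diff_right sum_subtractf mult.commute algebra_simps)
  have rank_one: "norm (?P i j *\<^sub>R ((h \<bullet> ?u j) *\<^sub>R ?u i - (h \<bullet> ?v j) *\<^sub>R ?v i))
      \<le> ?Q i j * (norm (?u j) * norm (?u i - ?v i) + norm (?u j - ?v j) * norm (?v i)) * norm h" for i j
  proof -
    have "(h \<bullet> ?u j) *\<^sub>R ?u i - (h \<bullet> ?v j) *\<^sub>R ?v i
        = (h \<bullet> ?u j) *\<^sub>R (?u i - ?v i) + (h \<bullet> (?u j - ?v j)) *\<^sub>R ?v i"
      by (simp add: algebra_simps inner_diff_right)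
    also have "norm \<dots> \<le> \<bar>h \<bullet> ?u j\<bar> * norm (?u i - ?v i) + \<bar>h \<bullet> (?u j - ?v j)\<bar> * norm (?v i)"
      by (rule order_trans[OF norm_triangle_ineq]) simp
    also have "\<dots> \<le> norm h * norm (?u j) * norm (?u i - ?v i) + norm h * norm (?u j - ?v j) * norm (?v i)"
      by (intro add_mono mult_right_mono Cauchy_Schwarz_ineq2) auto
    finally have le: "norm ((h \<bullet> ?u j) *\<^sub>R ?u i - (h \<bullet> ?v j) *\<^sub>R ?v i)
        \<le> (norm (?u j) * norm (?u i - ?v i) + norm (?u j - ?v j) * norm (?v i)) * norm h"
      by (simp add: algebra_simps)
    have "0 \<le> ?Q i j"
      by (simp add: prod_nonneg)
    then show ?thesis
      using mult_left_mono[OF le] by (simp add: abs_prod mult.assoc)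
  qed
  \<comment> \<open>After the exchange both halves contain the difference
    \<open>?u i - ?v i\<close>. It factors out of the inner sum and leaves
    \<open>norm (?u j) + norm (?v j)\<close>.\<close>
  have swap: "(\<Sum>i\<in>I. \<Sum>j\<in>I - {i}. ?Q i j * (norm (?u j - ?v j) * norm (?v i)))
      = (\<Sum>i\<in>I. \<Sum>j\<in>I - {i}. ?Q i j * (norm (?u i - ?v i) * norm (?v j)))"
  proof -
    let ?T = "\<lambda>i j. ?Q i j * (norm (?u j - ?v j) * norm (?v i))"
    \<comment> \<open>The inner index set depends on the outer index, so the sums are swapped under
      the explicit condition \<open>i \<noteq> j\<close>.\<close>
    have "(\<Sum>i\<in>I. \<Sum>j\<in>I - {i}. ?T i j) = (\<Sum>i\<in>I. \<Sum>j | j \<in> I \<and> i \<noteq> j. ?T i j)"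
      by (intro sum.cong) auto
    also have "\<dots> = (\<Sum>j\<in>I. \<Sum>i | i \<in> I \<and> i \<noteq> j. ?T i j)"
      by (rule sum.swap_restrict[OF fin fin])
    also have "\<dots> = (\<Sum>j\<in>I. \<Sum>i\<in>I - {j}. ?T i j)"
      by (intro sum.cong) auto
    finally show ?thesis
      by (simp add: insert_commute)
  qed
  have "norm (\<Sum>i\<in>I. \<Sum>j\<in>I - {i}. ?P i j *\<^sub>R ((h \<bullet> ?u j) *\<^sub>R ?u i - (h \<bullet> ?v j) *\<^sub>R ?v i))
      \<le> (\<Sum>i\<in>I. \<Sum>j\<in>I - {i}.
          ?Q i j * (norm (?u j) * norm (?u i - ?v i) + norm (?u j - ?v j) * norm (?v i)) * norm h)"
    by (intro sum_norm_le rank_one)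
  also have "\<dots> = ((\<Sum>i\<in>I. \<Sum>j\<in>I - {i}. ?Q i j * (norm (?u j) * norm (?u i - ?v i)))
      + (\<Sum>i\<in>I. \<Sum>j\<in>I - {i}. ?Q i j * (norm (?u j - ?v j) * norm (?v i)))) * norm h"
    by (simp add: sum_distrib_right distrib_left distrib_right sum.distrib)
  also have "\<dots> = ?G * norm h"
    unfolding swap
    by (simp add: sum_distrib_left sum_distrib_right distrib_left distrib_right sum.distrib mult_ac)
  finally have G: "norm (\<Sum>i\<in>I. \<Sum>j\<in>I - {i}. ?P i j *\<^sub>R ((h \<bullet> ?u j) *\<^sub>R ?u i - (h \<bullet> ?v j) *\<^sub>R ?v i))
      \<le> ?G * norm h" .
  have "norm (\<Sum>i\<in>I. ?F i *\<^sub>R ((?A i - ?B i) *v h))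
      \<le> (\<Sum>i\<in>I. \<bar>?F i\<bar> * (matrix_norm (?A i - ?B i) * norm h))"
    by (intro sum_norm_le) (simp add: mult_left_mono matrix_norm_mult_le)
  then have H: "norm (\<Sum>i\<in>I. ?F i *\<^sub>R ((?A i - ?B i) *v h)) \<le> ?H * norm h"
    by (simp add: sum_distrib_right mult.assoc)
  show "norm ((hessian (\<lambda>x. \<Prod>i\<in>I. f i x) x - hessian (\<lambda>x. \<Prod>i\<in>I. g i x) x) *v h) \<le> (?G + ?H) * norm h"
    unfolding diff distrib_right using norm_triangle_mono[OF G H] .
qed

section \<open>Bounds for gradients and for powers of the radius\<close>

text \<open>The final accuracy claim comes without given gradient bounds; compactness of the ball
  provides them.\<close>

lemma C2_grad_bounded_cball:
  fixes f :: "real ^ 'd \<Rightarrow> real"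
  assumes "C2 f"
  shows "\<exists>M. \<forall>x\<in>cball x0 r. norm (grad f x) \<le> M"
proof -
  have "continuous_on (cball x0 r) (grad f)"
    using assms unfolding C2_def twice_differentiable_def
    by (simp add: continuous_at_imp_continuous_on differentiable_imp_continuous_within)
  then have "bounded (grad f ` cball x0 r)"
    by (intro compact_imp_bounded compact_continuous_image compact_cball)
  then show ?thesis
    unfolding bounded_iff by auto
qed

text \<open>This reduces all accuracy orders to their minimum \<open>M\<close>: the surplus power
  has a nonnegative exponent, so it is largest at the maximal radius \<open>D\<close>.\<close>

lemma powr_le_powr_diff_mult:
  fixes d D N M :: real
  assumes "0 < d" "d \<le> D" "M \<le> N"
  shows "d powr N \<le> D powr (N - M) * d powr M"
proof -
  have "d powr N = d powr (N - M) * d powr M"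
    by (simp add: powr_add[symmetric])
  also have "\<dots> \<le> D powr (N - M) * d powr M"
    using assms by (intro mult_right_mono powr_mono2) auto
  finally show ?thesis .
qed

theorem theorem19:
  fixes n :: nat and x0 :: "real ^ 'd" and \<Delta>max :: real
    and f :: "nat \<Rightarrow> real ^ 'd \<Rightarrow> real"
    and m :: "nat \<Rightarrow> real \<Rightarrow> real ^ 'd \<Rightarrow> real"
    and Ng Nh \<kappa>g \<kappa>h :: "nat \<Rightarrow> real"
  assumes "n \<ge> 1" and "\<Delta>max > 0"
    and "\<And>i. i \<in> {1..n} \<Longrightarrow> C2 (f i)"
    and "\<And>i. i \<in> {1..n} \<Longrightarrow> Ng i \<ge> 0 \<and> Nh i \<ge> 0"
    and "\<And>i. i \<in> {1..n} \<Longrightarrow> \<kappa>g i \<ge> 0 \<and> \<kappa>h i \<ge> 0"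
    and "\<And>i. i \<in> {1..n} \<Longrightarrow> exact_function_accuracy (f i) (m i) \<Delta>max x0"
    and "\<And>i. i \<in> {1..n} \<Longrightarrow> gradient_accuracy (f i) (m i) \<Delta>max x0 (Ng i) (\<kappa>g i)"
    and "\<And>i. i \<in> {1..n} \<Longrightarrow> hessian_accuracy (f i) (m i) \<Delta>max x0 (Nh i) (\<kappa>h i)"
  shows
    "let F = (\<lambda>x. \<Prod>i\<in>{1..n}. f i x);
         Fm = (\<lambda>\<Delta> x. \<Prod>i\<in>{1..n}. m i \<Delta> x);
         Fi = (\<lambda>i x. \<Prod>j\<in>{1..n} - {i}. f j x);
         NF = Min (Ng ` {1..n} \<union> Nh ` {1..n})
     in (\<forall>Mf Mm :: nat \<Rightarrow> real.
           (\<forall>i\<in>{1..n}. \<forall>x\<in>cball x0 \<Delta>max. norm (grad (f i) x) \<le> Mf i) \<longrightarrow>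
           (\<forall>i\<in>{1..n}. \<forall>\<Delta>\<in>{0<..\<Delta>max}. norm (grad (m i \<Delta>) x0) \<le> Mm i) \<longrightarrow>
           (let K = (\<Sum>i\<in>{1..n}.
                       (\<Sum>j\<in>{1..n} - {i}. (\<Prod>k\<in>{1..n} - {i, j}. \<bar>f k x0\<bar>) * (Mf j + Mm j))
                         * \<kappa>g i * \<Delta>max powr (Ng i - NF))
                  + (\<Sum>i\<in>{1..n}. \<bar>Fi i x0\<bar> * \<kappa>h i * \<Delta>max powr (Nh i - NF))
            in \<forall>\<Delta>\<in>{0<..\<Delta>max}.
                 matrix_norm (hessian F x0 - hessian (Fm \<Delta>) x0) \<le> K * \<Delta> powr NF))
        \<and> provides_hessian_accuracy F Fm \<Delta>max x0 NF"
proof -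
  define F where "F = (\<lambda>x. \<Prod>i\<in>{1..n}. f i x)"
  define Fm where "Fm = (\<lambda>\<Delta> x. \<Prod>i\<in>{1..n}. m i \<Delta> x)"
  define NF where "NF = Min (Ng ` {1..n} \<union> Nh ` {1..n})"
  \<comment> \<open>The constant is a function of the bounds because it serves both arbitrary bounds
    and the particular ones constructed below.\<close>
  define K where "K = (\<lambda>Mf Mm :: nat \<Rightarrow> real. (\<Sum>i\<in>{1..n}.
       (\<Sum>j\<in>{1..n} - {i}. (\<Prod>k\<in>{1..n} - {i, j}. \<bar>f k x0\<bar>) * (Mf j + Mm j))
         * \<kappa>g i * \<Delta>max powr (Ng i - NF))
     + (\<Sum>i\<in>{1..n}. \<bar>\<Prod>j\<in>{1..n} - {i}. f j x0\<bar> * \<kappa>h i * \<Delta>max powr (Nh i - NF)))"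
  have NF: "NF \<le> Ng i" "NF \<le> Nh i" if "i \<in> {1..n}" for i
    using that unfolding NF_def by (auto intro!: Min_le)
  have f2: "twice_differentiable (f i)" if "i \<in> {1..n}" for i
    using assms(3)[OF that] unfolding C2_def by blast
  have m2: "twice_differentiable (m i \<Delta>)" if "i \<in> {1..n}" "\<Delta> \<in> {0<..\<Delta>max}" for i \<Delta>
    using assms(8)[OF that(1)] that(2) unfolding hessian_accuracy_def by blast
  have grad_le: "norm (grad (f i) x0 - grad (m i \<Delta>) x0) \<le> \<kappa>g i * \<Delta> powr Ng i"
    if "i \<in> {1..n}" "\<Delta> \<in> {0<..\<Delta>max}" for i \<Delta>
    using assms(7)[OF that(1)] that(2) unfolding gradient_accuracy_def by blast
  have hess_le: "matrix_norm (hessian (f i) x0 - hessian (m i \<Delta>) x0) \<le> \<kappa>h i * \<Delta> powr Nh i"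
    if "i \<in> {1..n}" "\<Delta> \<in> {0<..\<Delta>max}" for i \<Delta>
    using assms(8)[OF that(1)] that(2) unfolding hessian_accuracy_def by blast
  have main: "matrix_norm (hessian F x0 - hessian (Fm \<Delta>) x0) \<le> K Mf Mm * \<Delta> powr NF"
    if Mf: "\<forall>i\<in>{1..n}. \<forall>x\<in>cball x0 \<Delta>max. norm (grad (f i) x) \<le> Mf i"
      and Mm: "\<forall>i\<in>{1..n}. \<forall>\<Delta>\<in>{0<..\<Delta>max}. norm (grad (m i \<Delta>) x0) \<le> Mm i"
      and \<Delta>: "\<Delta> \<in> {0<..\<Delta>max}" for Mf Mm \<Delta>
  proof -
    let ?I = "{1..n}"
    let ?Q = "\<lambda>i j. \<Prod>k\<in>?I - {i, j}. \<bar>f k x0\<bar>"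
    let ?F = "\<lambda>i. \<bar>\<Prod>j\<in>?I - {i}. f j x0\<bar>"
    \<comment> \<open>The bound is evaluated at the centre, which lies in the ball because
      \<open>\<Delta>max\<close> is positive.\<close>
    have u: "norm (grad (f i) x0) \<le> Mf i" if "i \<in> ?I" for i
      using Mf that \<open>\<Delta>max > 0\<close> by simp
    have v: "norm (grad (m i \<Delta>) x0) \<le> Mm i" if "i \<in> ?I" for i
      using Mm that \<Delta> by blast
    have e: "norm (grad (f i) x0 - grad (m i \<Delta>) x0) \<le> \<kappa>g i * (\<Delta>max powr (Ng i - NF) * \<Delta> powr NF)"
      if "i \<in> ?I" for i
      using assms(5)[OF that] NF(1)[OF that] \<Delta>
      by (intro order_trans[OF grad_le[OF that \<Delta>] mult_left_mono[OF powr_le_powr_diff_mult]]) auto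
    have e': "matrix_norm (hessian (f i) x0 - hessian (m i \<Delta>) x0)
        \<le> \<kappa>h i * (\<Delta>max powr (Nh i - NF) * \<Delta> powr NF)"
      if "i \<in> ?I" for i
      using assms(5)[OF that] NF(2)[OF that] \<Delta>
      by (intro order_trans[OF hess_le[OF that \<Delta>] mult_left_mono[OF powr_le_powr_diff_mult]]) auto
    \<comment> \<open>The bounds are nonnegative since they dominate norms; the monotonicity of the
      products below depends on this.\<close>
    have M0: "0 \<le> Mf i + Mm i" if "i \<in> ?I" for i
      using u[OF that] v[OF that] by (meson add_nonneg_nonneg norm_ge_zero order_trans)
    have "matrix_norm (hessian F x0 - hessian (Fm \<Delta>) x0) \<le>
        (\<Sum>i\<in>?I. (\<Sum>j\<in>?I - {i}. ?Q i j * (norm (grad (f j) x0) + norm (grad (m j \<Delta>) x0)))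
          * norm (grad (f i) x0 - grad (m i \<Delta>) x0))
        + (\<Sum>i\<in>?I. ?F i * matrix_norm (hessian (f i) x0 - hessian (m i \<Delta>) x0))"
      unfolding F_def Fm_def
      by (rule matrix_norm_hessian_prod_diff_le)
        (use f2 m2 \<Delta> assms(6) in \<open>auto simp: exact_function_accuracy_def\<close>)
    also have "\<dots> \<le> (\<Sum>i\<in>?I. (\<Sum>j\<in>?I - {i}. ?Q i j * (Mf j + Mm j))
          * (\<kappa>g i * (\<Delta>max powr (Ng i - NF) * \<Delta> powr NF)))
        + (\<Sum>i\<in>?I. ?F i * (\<kappa>h i * (\<Delta>max powr (Nh i - NF) * \<Delta> powr NF)))"
      by (intro add_mono sum_mono mult_mono mult_left_mono u v e e' sum_nonneg mult_nonneg_nonneg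
          prod_nonneg M0) auto
    also have "\<dots> = K Mf Mm * \<Delta> powr NF"
      unfolding K_def by (simp add: distrib_right sum_distrib_right mult.assoc)
    finally show ?thesis .
  qed
  have "provides_hessian_accuracy F Fm \<Delta>max x0 NF"
  proof -
    have "\<forall>i\<in>{1..n}. \<exists>M. \<forall>x\<in>cball x0 \<Delta>max. norm (grad (f i) x) \<le> M"
      using C2_grad_bounded_cball assms(3) by blast
    then obtain Mf where Mf: "\<forall>i\<in>{1..n}. \<forall>x\<in>cball x0 \<Delta>max. norm (grad (f i) x) \<le> Mf i"
      by metis
    \<comment> \<open>The triangle inequality gives this bound, with
      \<open>\<Delta> powr Ng i\<close> replaced by its value at the maximal radius, which is
      legitimate as \<open>Ng i\<close> is nonnegative.\<close>
    define Mm where "Mm i = Mf i + \<kappa>g i * \<Delta>max powr Ng i" for i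
    have Mm: "\<forall>i\<in>{1..n}. \<forall>\<Delta>\<in>{0<..\<Delta>max}. norm (grad (m i \<Delta>) x0) \<le> Mm i"
    proof (intro ballI)
      fix i \<Delta> assume i: "i \<in> {1..n}" and \<Delta>: "\<Delta> \<in> {0<..\<Delta>max}"
      have "norm (grad (m i \<Delta>) x0) \<le> norm (grad (f i) x0) + norm (grad (f i) x0 - grad (m i \<Delta>) x0)"
        by (metis norm_minus_commute norm_triangle_sub)
      also have "\<dots> \<le> Mf i + \<kappa>g i * \<Delta>max powr Ng i"
      proof (rule add_mono)
        show "norm (grad (f i) x0) \<le> Mf i"
          using Mf i \<open>\<Delta>max > 0\<close> by simp
        show "norm (grad (f i) x0 - grad (m i \<Delta>) x0) \<le> \<kappa>g i * \<Delta>max powr Ng i"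
          using assms(4,5)[OF i] \<Delta>
          by (intro order_trans[OF grad_le[OF i \<Delta>]] mult_left_mono powr_mono2) auto
      qed
      finally show "norm (grad (m i \<Delta>) x0) \<le> Mm i"
        unfolding Mm_def .
    qed
    \<comment> \<open>The absolute value makes the constant nonnegative, as
      \<open>provides_hessian_accuracy\<close> demands, and can only enlarge the bound.\<close>
    have "hessian_accuracy F Fm \<Delta>max x0 NF \<bar>K Mf Mm\<bar>"
      unfolding hessian_accuracy_def
    proof (intro ballI conjI)
      fix \<Delta> assume \<Delta>: "\<Delta> \<in> {0<..\<Delta>max}"
      show "twice_differentiable (Fm \<Delta>)"
        unfolding Fm_def using m2 \<Delta> by (intro twice_differentiable_prod) blast
      show "matrix_norm (hessian F x0 - hessian (Fm \<Delta>) x0) \<le> \<bar>K Mf Mm\<bar> * \<Delta> powr NF"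
        by (rule order_trans[OF main[OF Mf Mm \<Delta>]]) (simp add: mult_right_mono)
    qed
    then show ?thesis
      unfolding provides_hessian_accuracy_def by (meson abs_ge_zero)
  qed
  then show ?thesis
    using main unfolding Let_def F_def Fm_def NF_def K_def by blast
qed

end
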